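(* Let $G=\mathrm{SL}(2,\mathbb{R})\ltimes\mathbb{R}^2$ and let $L_G\subset \mathrm{Sub}_G$ be the set of all Levi subgroups of $G$. Then any subgroup in the closure $\overline{L_G}$ (taken in $\mathrm{Sub}_G$ with the Chabauty topology) is either a Levi subgroup of $G$ or a conjugate in $G$ of $N^+\ltimes\mathbb{R}^2$.
   Context: Elements of $G=\mathrm{SL}(2,\mathbb{R})\ltimes\mathbb{R}^2$ are written $(g,v)$ with $g\in\mathrm{SL}(2,\mathbb{R})$, $v\in\mathbb{R}^2$, with group operation $(g,v)(g',v')=(gg',v+g(v'))$. $\mathrm{SL}(2,\mathbb{R})$ and $\mathbb{R}^2$ are identified with closed subgroups of $G$ via $g\mapsto(g,(0,0))$ and $v\mapsto(I,v)$. The Levi subgroups of $G$ are exactly the conjugates in $G$ of $L=\mathrm{SL}(2,\mathbb{R})$, i.e. $L_G=\{xLx^{-1}\mid x\in G\}$. $N^+=\left\{\begin{pmatrix}1&x\\0&1\end{pmatrix}: x\in\mathbb{R}\right\}\subset\mathrm{SL}(2,\mathbb{R})$, and $N^+\ltimes\mathbb{R}^2=\{(n,v): n\in N^+, v\in\mathbb{R}^2\}$. $\mathrm{Sub}_G$ is the space of closed subgroups of $G$ with the Chabauty topology, generated by the sets $\{H\in\mathrm{Sub}_G\mid H\cap C=\emptyset\}$ for $C\subset G$ compact and $\{H\in\mathrm{Sub}_G\mid H\cap U\neq\emptyset\}$ for $U\subset G$ open; it is compact and metrizable. Equivalently, $H_n\to H$ iff every $h\in H$ is a limit of some sequence $h_n\in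 H_n$, and whenever $x_{k_n}\in H_{k_n}$ with $k_{n+1}>k_n$ and $x_{k_n}\to x$, one has $x\in H$. *)

theory Defs
  imports "HOL-Analysis.Analysis" "HOL-Algebra.Group_Action"
begin

text \<open>A topological group is given by a group structure \<open>G\<close> together with an abstract
  topology \<open>T\<close> whose space is the carrier of \<open>G\<close>.\<close>

definition closed_subgroups :: "('a, 'b) monoid_scheme \<Rightarrow> 'a topology \<Rightarrow> 'a set set" where
  "closed_subgroups G T = {H. subgroup H G \<and> closedin T H}"

definition chabauty_topology :: "('a, 'b) monoid_scheme \<Rightarrow> 'a topology \<Rightarrow> 'a set topology" where
  "chabauty_topology G T = topology_generated_by
     ({{H \<in> closed_subgroups G T. H \<inter> C = {}} | C. compactin T C} \<union>
      {{H \<in> closed_subgroups G T. H \<inter> U \<noteq> {}} | U. openin T U})"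

lemma topspace_chabauty_topology [simp]:
  "topspace (chabauty_topology G T) = closed_subgroups G T"
proof -
  have "closed_subgroups G T \<in> {{H \<in> closed_subgroups G T. H \<inter> C = {}} | C. compactin T C}"
    by (rule CollectI, rule exI[of _ "{}"]) auto
  then show ?thesis
    unfolding chabauty_topology_def topology_generated_by_topspace by blast
qed

definition conjugate_subgroup :: "('a, 'b) monoid_scheme \<Rightarrow> 'a \<Rightarrow> 'a set \<Rightarrow> 'a set" where
  "conjugate_subgroup G x H = x <#\<^bsub>G\<^esub> H #>\<^bsub>G\<^esub> inv\<^bsub>G\<^esub> x"

definition SL2 :: "(real^2^2) set" where
  "SL2 = {g. det g = 1}"

definition SL2_R2 :: "((real^2^2) \<times> (real^2)) monoid" where
  "SL2_R2 = \<lparr>carrier = SL2 \<times> UNIV,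
             mult = (\<lambda>(g, v) (g', v'). (g ** g', v + g *v v')),
             one = (mat 1, 0)\<rparr>"

definition SL2_R2_topology :: "((real^2^2) \<times> (real^2)) topology" where
  "SL2_R2_topology = top_of_set (carrier SL2_R2)"

lemma group_SL2_R2: "group SL2_R2"
proof (rule groupI)
  fix x assume "x \<in> carrier SL2_R2"
  then obtain g v where x: "x = (g, v)" and g: "det g = 1"
    by (auto simp: SL2_R2_def SL2_def)
  obtain h where h: "h ** g = mat 1"
    using g by (metis invertible_det_nz invertible_left_inverse zero_neq_one)
  have "det h = 1"
    using arg_cong[OF h, of det] g by (simp add: det_mul)
  then show "\<exists>y\<in>carrier SL2_R2. y \<otimes>\<^bsub>SL2_R2\<^esub> x = \<one>\<^bsub>SL2_R2\<^esub>"
    by (intro bexI[of _ "(h, - (h *v v))"]) (auto simp: SL2_R2_def SL2_def x h)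
qed (auto simp: SL2_R2_def SL2_def det_mul matrix_mul_assoc matrix_vector_right_distrib
       matrix_vector_mul_assoc)

definition SL2_subgroup :: "((real^2^2) \<times> (real^2)) set" where
  "SL2_subgroup = (\<lambda>g. (g, 0)) ` SL2"

text \<open>By Malcev's theorem the Levi subgroups of \<open>SL(2,\<real>) \<ltimes> \<real>\<^sup>2\<close> are exactly the conjugates of
  the standard copy of \<open>SL(2,\<real>)\<close>; this description is taken as the definition.\<close>

definition Levi_subgroups :: "((real^2^2) \<times> (real^2)) set set" where
  "Levi_subgroups = {conjugate_subgroup SL2_R2 x SL2_subgroup | x. x \<in> carrier SL2_R2}"

definition N_plus :: "(real^2^2) set" where
  "N_plus = {vector [vector [1, x], vector [0, 1]] | x. True}"

definition N_plus_R2 :: "((real^2^2) \<times> (real^2)) set" where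
  "N_plus_R2 = N_plus \<times> UNIV"

lemma subgroup_SL2_subgroup: "subgroup SL2_subgroup SL2_R2"
proof -
  interpret group SL2_R2 by (rule group_SL2_R2)
  show ?thesis
  proof (rule subgroupI)
    fix a assume "a \<in> SL2_subgroup"
    then obtain g where a: "a = (g, 0)" and g: "det g = 1"
      by (auto simp: SL2_subgroup_def SL2_def)
    obtain h where h: "h ** g = mat 1"
      using g by (metis invertible_det_nz invertible_left_inverse zero_neq_one)
    have dh: "det h = 1"
      using arg_cong[OF h, of det] g by (simp add: det_mul)
    have "inv\<^bsub>SL2_R2\<^esub> a = (h, 0)"
      by (rule inv_equality) (auto simp: SL2_R2_def SL2_def a g h dh)
    then show "inv\<^bsub>SL2_R2\<^esub> a \<in> SL2_subgroup"
      using dh by (auto simp: SL2_subgroup_def SL2_def)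
  next
    have "(mat 1, 0) \<in> SL2_subgroup" by (auto simp: SL2_subgroup_def SL2_def)
    then show "SL2_subgroup \<noteq> {}" by blast
  qed (auto simp: SL2_subgroup_def SL2_R2_def SL2_def det_mul)
qed

lemma closedin_SL2_subgroup: "closedin SL2_R2_topology SL2_subgroup"
proof -
  have "SL2_subgroup = carrier SL2_R2 \<inter> UNIV \<times> {0}"
    by (auto simp: SL2_subgroup_def SL2_R2_def)
  then show ?thesis
    unfolding SL2_R2_topology_def by (metis closed_Times closed_UNIV closed_singleton closedin_closed_Int)
qed

lemma continuous_on_left_mult:
  "continuous_on (carrier SL2_R2) (\<lambda>y. x \<otimes>\<^bsub>SL2_R2\<^esub> y)"
  and continuous_on_right_mult:
  "continuous_on (carrier SL2_R2) (\<lambda>y. y \<otimes>\<^bsub>SL2_R2\<^esub> x)"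
  unfolding SL2_R2_def matrix_matrix_mult_def matrix_vector_mult_def case_prod_unfold
  by (auto intro!: continuous_intros)

lemma Levi_subgroups_closed: "Levi_subgroups \<subseteq> closed_subgroups SL2_R2 SL2_R2_topology"
proof
  interpret group SL2_R2 by (rule group_SL2_R2)
  fix H assume "H \<in> Levi_subgroups"
  then obtain x where x: "x \<in> carrier SL2_R2"
    and H: "H = x <#\<^bsub>SL2_R2\<^esub> SL2_subgroup #>\<^bsub>SL2_R2\<^esub> inv\<^bsub>SL2_R2\<^esub> x"
    by (auto simp: Levi_subgroups_def conjugate_subgroup_def)
  let ?c = "\<lambda>y. inv\<^bsub>SL2_R2\<^esub> x \<otimes>\<^bsub>SL2_R2\<^esub> (y \<otimes>\<^bsub>SL2_R2\<^esub> x)"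
  have sub: "l \<in> carrier SL2_R2" if "l \<in> SL2_subgroup" for l
    using subgroup.subset[OF subgroup_SL2_subgroup] that by blast
  have eq: "H = {y \<in> carrier SL2_R2. ?c y \<in> SL2_subgroup}"
  proof (intro equalityI subsetI)
    fix y assume "y \<in> H"
    then obtain l where l: "l \<in> SL2_subgroup"
      and y: "y = x \<otimes>\<^bsub>SL2_R2\<^esub> l \<otimes>\<^bsub>SL2_R2\<^esub> inv\<^bsub>SL2_R2\<^esub> x"
      by (auto simp: H l_coset_def r_coset_def)
    have "?c y = l"
      using x sub[OF l] unfolding y by (simp add: m_assoc inv_solve_left')
    then show "y \<in> {y \<in> carrier SL2_R2. ?c y \<in> SL2_subgroup}"
      using x l sub[OF l] by (simp add: y)
  next
    fix y assume y: "y \<in> {y \<in> carrier SL2_R2. ?c y \<in> SL2_subgroup}"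
    then have "y = x \<otimes>\<^bsub>SL2_R2\<^esub> ?c y \<otimes>\<^bsub>SL2_R2\<^esub> inv\<^bsub>SL2_R2\<^esub> x"
      using x by (simp add: m_assoc) (simp add: m_assoc [symmetric])
    then show "y \<in> H"
      using y unfolding H l_coset_def r_coset_def by blast
  qed
  have sg: "subgroup H SL2_R2"
    unfolding H by (rule subgroup_conjugation_is_surj2 [OF x subgroup_SL2_subgroup])
  have "continuous_on (carrier SL2_R2) ?c"
    using x by (intro continuous_on_compose2[OF continuous_on_left_mult continuous_on_right_mult]) auto
  then have "continuous_map SL2_R2_topology SL2_R2_topology ?c"
    using x by (auto simp: SL2_R2_topology_def continuous_map_in_subtopology)
  from closedin_continuous_map_preimage[OF this closedin_SL2_subgroup]
  have "closedin SL2_R2_topology H"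
    by (simp add: eq SL2_R2_topology_def)
  with sg show "H \<in> closed_subgroups SL2_R2 SL2_R2_topology"
    by (simp add: closed_subgroups_def)
qed

end

theory Submission
  imports Defs
begin

text \<open>The Levi subgroup obtained by conjugating with a translation \<open>w\<close> is
  \<open>{(g, v). w - g w = v}\<close>. In homogeneous coordinates \<open>(s, u)\<close> for \<open>w = u / s\<close> its equation becomes
  \<open>u - g u = s v\<close>, which makes sense for every point of the unit sphere, a
  compact set. The resulting subgroup depends continuously on \<open>(s, u)\<close> in the Chabauty sense, so by
  compactness every limit of Levi subgroups is one of these subgroups. The points with
  \<open>s = 0\<close> give \<open>Stab(u) \<ltimes> \<real>\<^sup>2\<close>, a conjugate of \<open>N\<^sup>+ \<ltimes> \<real>\<^sup>2\<close>.\<close>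

definition homogeneous_Levi :: "real \<times> (real^2) \<Rightarrow> ((real^2^2) \<times> (real^2)) set" where
  "homogeneous_Levi p = {(g, v). g \<in> SL2 \<and> snd p - g *v snd p = fst p *\<^sub>R v}"

section \<open>Conjugation in the semidirect product\<close>

lemma mem_conjugate_subgroup_iff:
  assumes "group G" "x \<in> carrier G" "H \<subseteq> carrier G"
  shows "y \<in> conjugate_subgroup G x H \<longleftrightarrow>
    y \<in> carrier G \<and> inv\<^bsub>G\<^esub> x \<otimes>\<^bsub>G\<^esub> (y \<otimes>\<^bsub>G\<^esub> x) \<in> H"
proof -
  interpret group G by fact
  show ?thesis
  proof
    assume "y \<in> conjugate_subgroup G x H"
    then obtain l where l: "l \<in> H" and y: "y = x \<otimes>\<^bsub>G\<^esub> l \<otimes>\<^bsub>G\<^esub> inv\<^bsub>G\<^esub> x"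
      by (auto simp: conjugate_subgroup_def l_coset_def r_coset_def)
    have lc: "l \<in> carrier G" using l assms(3) by blast
    have "inv\<^bsub>G\<^esub> x \<otimes>\<^bsub>G\<^esub> (y \<otimes>\<^bsub>G\<^esub> x) = l"
      using assms(2) lc unfolding y by (simp add: m_assoc inv_solve_left')
    then show "y \<in> carrier G \<and> inv\<^bsub>G\<^esub> x \<otimes>\<^bsub>G\<^esub> (y \<otimes>\<^bsub>G\<^esub> x) \<in> H"
      using assms(2) l lc by (simp add: y)
  next
    assume y: "y \<in> carrier G \<and> inv\<^bsub>G\<^esub> x \<otimes>\<^bsub>G\<^esub> (y \<otimes>\<^bsub>G\<^esub> x) \<in> H"
    then have "y = x \<otimes>\<^bsub>G\<^esub> (inv\<^bsub>G\<^esub> x \<otimes>\<^bsub>G\<^esub> (y \<otimes>\<^bsub>G\<^esub> x)) \<otimes>\<^bsub>G\<^esub> inv\<^bsub>G\<^esub> x"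
      using assms(2) by (simp add: m_assoc) (simp add: m_assoc [symmetric])
    then show "y \<in> conjugate_subgroup G x H"
      using y unfolding conjugate_subgroup_def l_coset_def r_coset_def by blast
  qed
qed

lemma SL2_inverse:
  assumes "k \<in> SL2"
  obtains k' where "k' \<in> SL2" "k' ** k = mat 1" "k ** k' = mat 1"
proof -
  have "invertible k"
    using assms by (simp add: SL2_def invertible_det_nz)
  then obtain k' where k': "k ** k' = mat 1" "k' ** k = mat 1"
    unfolding invertible_def by blast
  have "det k' = 1"
    using arg_cong[OF k'(2), of det] assms by (simp add: det_mul SL2_def)
  then show ?thesis
    using that k' by (simp add: SL2_def)
qed

lemma SL2_mult: "g \<in> SL2 \<Longrightarrow> h \<in> SL2 \<Longrightarrow> g ** h \<in> SL2"
  by (simp add: SL2_def det_mul)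

lemma mult_vec_eq_iff:
  fixes k :: "real^2^2"
  assumes "k' ** k = mat 1" "k ** k' = mat 1"
  shows "k' *v x = y \<longleftrightarrow> x = k *v y"
  using assms by (metis matrix_vector_mul_assoc matrix_vector_mul_lid)

text \<open>The inverse of \<open>(k, w)\<close> is \<open>(k', - (k' *v w))\<close>. Taking
  \<open>k'\<close> as a given matrix turns later membership tests into pure matrix algebra.\<close>

lemma conjugate_SL2_R2_expand:
  assumes "k' \<in> SL2" "k' ** k = mat 1" "k \<in> SL2"
  shows "inv\<^bsub>SL2_R2\<^esub> (k, w) \<otimes>\<^bsub>SL2_R2\<^esub> ((g, v) \<otimes>\<^bsub>SL2_R2\<^esub> (k, w)) =
    (k' ** (g ** k), k' *v (v + g *v w - w))"
proof -
  interpret group SL2_R2 by (rule group_SL2_R2)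
  have "inv\<^bsub>SL2_R2\<^esub> (k, w) = (k', - (k' *v w))"
    by (rule inv_equality) (use assms in \<open>auto simp: SL2_R2_def\<close>)
  then show ?thesis
    by (simp add: SL2_R2_def matrix_vector_right_distrib matrix_vector_mult_diff_distrib)
qed

lemma mem_conjugate_SL2_R2_iff:
  assumes "k' \<in> SL2" "k' ** k = mat 1" "k \<in> SL2" "H \<subseteq> carrier SL2_R2"
  shows "(g, v) \<in> conjugate_subgroup SL2_R2 (k, w) H \<longleftrightarrow>
    g \<in> SL2 \<and> (k' ** (g ** k), k' *v (v + g *v w - w)) \<in> H"
proof -
  have "(k, w) \<in> carrier SL2_R2" "(g, v) \<in> carrier SL2_R2 \<longleftrightarrow> g \<in> SL2"
    using assms(3) by (simp_all add: SL2_R2_def)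
  then show ?thesis
    by (simp add: mem_conjugate_subgroup_iff[OF group_SL2_R2 _ assms(4)]
        conjugate_SL2_R2_expand[OF assms(1-3)])
qed

section \<open>Levi subgroups in homogeneous coordinates\<close>

text \<open>Since \<open>(k, w)\<close> is the product of \<open>(mat 1, w)\<close> and
  \<open>(k, 0)\<close>, and \<open>(k, 0)\<close> lies in the standard Levi subgroup, only the
  translation part \<open>w\<close> matters.\<close>

lemma conjugate_SL2_subgroup:
  assumes k: "k \<in> SL2"
  shows "conjugate_subgroup SL2_R2 (k, w) SL2_subgroup = homogeneous_Levi (1, w)"
proof -
  obtain k' where k': "k' \<in> SL2" "k' ** k = mat 1" "k ** k' = mat 1"
    using SL2_inverse[OF k] .
  have "(g, v) \<in> conjugate_subgroup SL2_R2 (k, w) SL2_subgroup \<longleftrightarrow>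
    (g, v) \<in> homogeneous_Levi (1, w)" for g v
  proof -
    have "k' *v (v + g *v w - w) = 0 \<longleftrightarrow> w - g *v w = v"
      unfolding mult_vec_eq_iff[OF k'(2,3)] by (auto simp: algebra_simps)
    then show ?thesis
      using SL2_mult[OF k'(1) SL2_mult[OF _ k, of g]]
      unfolding mem_conjugate_SL2_R2_iff[OF k'(1,2) k subgroup.subset[OF subgroup_SL2_subgroup]]
      by (auto simp: homogeneous_Levi_def SL2_subgroup_def)
  qed
  then show ?thesis by auto
qed

lemma Levi_subgroups_eq: "Levi_subgroups = range (\<lambda>w. homogeneous_Levi (1, w))"
proof -
  have "Levi_subgroups = (\<Union>k\<in>SL2. range (\<lambda>w. conjugate_subgroup SL2_R2 (k, w) SL2_subgroup))"
    by (auto simp: Levi_subgroups_def SL2_R2_def)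
  also have "\<dots> = (\<Union>k\<in>SL2. range (\<lambda>w. homogeneous_Levi (1, w)))"
    by (simp add: conjugate_SL2_subgroup)
  also have "\<dots> = range (\<lambda>w. homogeneous_Levi (1, w))"
  proof -
    have "mat 1 \<in> SL2"
      by (simp add: SL2_def)
    then show ?thesis by blast
  qed
  finally show ?thesis .
qed

text \<open>The defining equation is homogeneous of degree one in the parameter, so the subgroup
  depends only on the line through it. Parameters may therefore be normalised to the unit
  sphere.\<close>

lemma homogeneous_Levi_scale:
  assumes "c \<noteq> 0"
  shows "homogeneous_Levi (c *\<^sub>R p) = homogeneous_Levi p"
proof -
  have "c *\<^sub>R u - g *v (c *\<^sub>R u) = (c * s) *\<^sub>R v \<longleftrightarrow> u - g *v u = s *\<^sub>R v"
    for u v :: "real^2" and g s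
  proof -
    have "c *\<^sub>R u - g *v (c *\<^sub>R u) = c *\<^sub>R (u - g *v u)"
      by (simp add: matrix_vector_mult_scaleR scaleR_diff_right)
    moreover have "(c * s) *\<^sub>R v = c *\<^sub>R (s *\<^sub>R v)"
      by simp
    ultimately show ?thesis
      using assms by (metis scaleR_cancel_left)
  qed
  then show ?thesis
    by (simp add: homogeneous_Levi_def)
qed

lemma homogeneous_Levi_in_Levi_subgroups:
  assumes "s \<noteq> 0"
  shows "homogeneous_Levi (s, u) \<in> Levi_subgroups"
proof -
  have "homogeneous_Levi (s *\<^sub>R (1, (1 / s) *\<^sub>R u)) = homogeneous_Levi (1, (1 / s) *\<^sub>R u)"
    using homogeneous_Levi_scale[OF assms] .
  then show ?thesis
    using assms by (simp add: Levi_subgroups_eq)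
qed

section \<open>Unimodular frames with prescribed first column\<close>

text \<open>The second column is \<open>a\<close> turned by a quarter turn and divided by its
  squared norm, which makes the determinant 1 for nonzero \<open>a\<close>. The explicit formula
  gives continuity away from 0.\<close>

definition column_frame :: "real^2 \<Rightarrow> real^2^2" where
  "column_frame a = (\<chi> i j. if j = 1 then a $ i
     else (if i = 1 then - a $ 2 else a $ 1) / (a \<bullet> a))"

text \<open>Writing the inverse out by its entries makes its continuity as direct as that of the
  frame itself.\<close>

definition column_frame_inverse :: "real^2 \<Rightarrow> real^2^2" where
  "column_frame_inverse a = (\<chi> i j. if i = 1 then a $ j / (a \<bullet> a)
     else if j = 1 then - a $ 2 else a $ 1)"

lemma inner_vec2: "(a :: real^2) \<bullet> a = a $ 1 * a $ 1 + a $ 2 * a $ 2"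
  by (simp add: inner_vec_def sum_2)

lemma column_frame_SL2:
  assumes "a \<noteq> 0"
  shows "column_frame a \<in> SL2" "column_frame_inverse a \<in> SL2"
  using assms inner_eq_zero_iff[of a] inner_vec2[of a, symmetric]
  by (auto simp: SL2_def det_2 column_frame_def column_frame_inverse_def field_simps)

lemma column_frame_inverse_right:
  assumes "a \<noteq> 0"
  shows "column_frame a ** column_frame_inverse a = mat 1"
  using assms inner_eq_zero_iff[of a] inner_vec2[of a, symmetric]
  by (auto simp: vec_eq_iff forall_2 matrix_matrix_mult_def sum_2 mat_def
      column_frame_def column_frame_inverse_def field_simps)

lemma column_frame_axis: "column_frame a *v axis 1 1 = a"
  by (auto simp: vec_eq_iff forall_2 matrix_vector_mult_def sum_2 axis_def column_frame_def)

lemma column_frame_inverse_self: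
  assumes "a \<noteq> 0"
  shows "column_frame_inverse a *v a = axis 1 1"
  using assms inner_eq_zero_iff[of a] inner_vec2[of a, symmetric]
  by (auto simp: vec_eq_iff forall_2 matrix_vector_mult_def sum_2 axis_def
      column_frame_inverse_def field_simps)

lemma tendsto_matrix_mult:
  fixes A B :: "'a \<Rightarrow> real^2^2"
  assumes "(A \<longlongrightarrow> a) F" "(B \<longlongrightarrow> b) F"
  shows "((\<lambda>x. A x ** B x) \<longlongrightarrow> a ** b) F"
  unfolding matrix_matrix_mult_def by (intro tendsto_intros tendsto_vec_lambda assms)

lemma tendsto_matrix_vector_mult:
  fixes A :: "'a \<Rightarrow> real^2^2"
  assumes "(A \<longlongrightarrow> a) F" "(B \<longlongrightarrow> b) F"
  shows "((\<lambda>x. A x *v B x) \<longlongrightarrow> a *v b) F"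
  unfolding matrix_vector_mult_def by (intro tendsto_intros tendsto_vec_lambda assms)

lemma tendsto_column_frame:
  assumes "(f \<longlongrightarrow> a) F" "a \<noteq> 0"
  shows "((\<lambda>x. column_frame (f x)) \<longlongrightarrow> column_frame a) F"
    "((\<lambda>x. column_frame_inverse (f x)) \<longlongrightarrow> column_frame_inverse a) F"
proof -
  have "((\<lambda>x. if j = 1 then f x $ i else (if i = 1 then - f x $ 2 else f x $ 1) / (f x \<bullet> f x)) \<longlongrightarrow>
      (if j = 1 then a $ i else (if i = 1 then - a $ 2 else a $ 1) / (a \<bullet> a))) F" for i j :: 2
    using assms by (cases "i = 1"; cases "j = 1"; simp) (auto intro!: tendsto_intros)
  then show "((\<lambda>x. column_frame (f x)) \<longlongrightarrow> column_frame a) F"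
    unfolding column_frame_def by (intro tendsto_vec_lambda)
  have "((\<lambda>x. if i = 1 then f x $ j / (f x \<bullet> f x) else if j = 1 then - f x $ 2 else f x $ 1) \<longlongrightarrow>
      (if i = 1 then a $ j / (a \<bullet> a) else if j = 1 then - a $ 2 else a $ 1)) F" for i j :: 2
    using assms by (cases "i = 1"; cases "j = 1"; simp) (auto intro!: tendsto_intros)
  then show "((\<lambda>x. column_frame_inverse (f x)) \<longlongrightarrow> column_frame_inverse a) F"
    unfolding column_frame_inverse_def by (intro tendsto_vec_lambda)
qed

section \<open>Subgroups at infinity\<close>

text \<open>Fixing the first basis vector determines the first column; determinant 1 then forces the
  lower right entry to be 1.\<close>

lemma N_plus_eq_stabilizer: "N_plus = {n \<in> SL2. n *v axis 1 1 = axis 1 1}"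
proof (intro equalityI subsetI)
  fix n assume "n \<in> {n \<in> SL2. n *v axis 1 1 = axis 1 1}"
  then have "n $ 1 $ 1 = 1 \<and> n $ 2 $ 1 = 0 \<and> n $ 2 $ 2 = 1"
    by (auto simp: SL2_def det_2 vec_eq_iff forall_2 matrix_vector_mult_def sum_2 axis_def)
  then have "n = vector [vector [1, n $ 1 $ 2], vector [0, 1]]"
    by (auto simp: vec_eq_iff forall_2)
  then show "n \<in> N_plus"
    unfolding N_plus_def by blast
qed (auto simp: N_plus_def SL2_def det_2 vec_eq_iff forall_2 matrix_vector_mult_def sum_2 axis_def)

text \<open>With first coordinate 0 the equation leaves \<open>v\<close> free and says that
  \<open>g\<close> fixes \<open>u\<close>. The frame of \<open>u\<close> sends the first basis
  vector to \<open>u\<close>, so it conjugates the stabiliser of that vector to the stabiliser of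
  \<open>u\<close>.\<close>

lemma homogeneous_Levi_at_infinity:
  assumes u: "u \<noteq> 0"
  shows "homogeneous_Levi (0, u) = conjugate_subgroup SL2_R2 (column_frame u, 0) N_plus_R2"
proof -
  let ?k = "column_frame u" and ?e = "axis 1 1 :: real^2"
  have k: "?k \<in> SL2"
    using column_frame_SL2[OF u] by blast
  obtain k' where k': "k' \<in> SL2" "k' ** ?k = mat 1" "?k ** k' = mat 1"
    using SL2_inverse[OF k] .
  have "(g, v) \<in> conjugate_subgroup SL2_R2 (?k, 0) N_plus_R2 \<longleftrightarrow>
    (g, v) \<in> homogeneous_Levi (0, u)" for g v
  proof -
    have "(k' ** (g ** ?k)) *v ?e = k' *v (g *v u)"
      by (simp add: matrix_vector_mul_assoc[symmetric] column_frame_axis)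
    then have "(k' ** (g ** ?k)) *v ?e = ?e \<longleftrightarrow> u - g *v u = 0"
      unfolding eq_iff_diff_eq_0[symmetric] by (auto simp: mult_vec_eq_iff[OF k'(2,3)] column_frame_axis)
    moreover have sub: "N_plus_R2 \<subseteq> carrier SL2_R2"
      by (auto simp: SL2_R2_def N_plus_R2_def N_plus_eq_stabilizer)
    ultimately show ?thesis
      using SL2_mult[OF k'(1) SL2_mult[OF _ k, of g]]
      unfolding mem_conjugate_SL2_R2_iff[OF k'(1,2) k sub]
      by (auto simp: homogeneous_Levi_def N_plus_R2_def N_plus_eq_stabilizer)
  qed
  then show ?thesis by auto
qed

section \<open>Local sections through points of the subgroups\<close>

text \<open>Lower semicontinuity. For \<open>s = 0\<close> a point \<open>(g, v)\<close> moves to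
  \<open>(M(u' - s' v) M(g u')\<^sup>-\<^sup>1 g, v)\<close>, where \<open>M\<close> is the frame with prescribed first column, so that
  the new linear part maps \<open>u'\<close> to \<open>u' - s' v\<close>.\<close>

lemma homogeneous_Levi_local_section:
  assumes gv: "(g, v) \<in> homogeneous_Levi p" and p: "p \<noteq> 0"
  obtains \<Phi> where "(\<Phi> \<longlongrightarrow> (g, v)) (nhds p)"
    "eventually (\<lambda>q. \<Phi> q \<in> homogeneous_Levi q) (nhds p)"
proof -
  have id: "((\<lambda>q. q) \<longlongrightarrow> p) (nhds p)"
    by (rule filterlim_ident)
  have g: "g \<in> SL2" and eq: "snd p - g *v snd p = fst p *\<^sub>R v"
    using gv by (auto simp: homogeneous_Levi_def)
  show ?thesis
  proof (cases "fst p = 0")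
    case False
    \<comment> \<open>Away from infinity \<open>g\<close> can be kept fixed, and the equation is
      solved for the translation part.\<close>
    define \<Phi> where "\<Phi> q = (g, (1 / fst q) *\<^sub>R (snd q - g *v snd q))" for q :: "real \<times> (real^2)"
    have "((\<lambda>q. (1 / fst q) *\<^sub>R (snd q - g *v snd q)) \<longlongrightarrow>
        (1 / fst p) *\<^sub>R (snd p - g *v snd p)) (nhds p)"
      using False by (intro tendsto_intros tendsto_matrix_vector_mult id) auto
    moreover have "(1 / fst p) *\<^sub>R (snd p - g *v snd p) = v"
      using False by (simp add: eq)
    ultimately have "(\<Phi> \<longlongrightarrow> (g, v)) (nhds p)"
      unfolding \<Phi>_def by (intro tendsto_intros) auto
    moreover have "eventually (\<lambda>q. fst q \<noteq> 0) (nhds p)"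
      using False by (intro tendsto_imp_eventually_ne[OF tendsto_fst[OF id]]) auto
    then have "eventually (\<lambda>q. \<Phi> q \<in> homogeneous_Levi q) (nhds p)"
      by eventually_elim (use g in \<open>auto simp: \<Phi>_def homogeneous_Levi_def\<close>)
    ultimately show ?thesis
      using that by blast
  next
    case True
    define a where "a q = g *v snd q" for q :: "real \<times> (real^2)"
    define b where "b q = snd q - fst q *\<^sub>R v" for q :: "real \<times> (real^2)"
    define h where "h q = column_frame (b q) ** column_frame_inverse (a q) ** g" for q
    have u: "snd p \<noteq> 0"
      using p True by (auto simp: prod_eq_iff)
    have "(a \<longlongrightarrow> g *v snd p) (nhds p)"
      unfolding a_def by (intro tendsto_intros tendsto_matrix_vector_mult id)
    then have a: "(a \<longlongrightarrow> snd p) (nhds p)"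
      using eq True by simp
    have "(b \<longlongrightarrow> snd p - fst p *\<^sub>R v) (nhds p)"
      unfolding b_def by (intro tendsto_intros id)
    then have b: "(b \<longlongrightarrow> snd p) (nhds p)"
      using True by simp
    \<comment> \<open>At infinity \<open>g\<close> fixes \<open>snd p\<close>, so \<open>a\<close>
      and \<open>b\<close> have the same limit and the two frame factors cancel there.\<close>
    have "(h \<longlongrightarrow> column_frame (snd p) ** column_frame_inverse (snd p) ** g) (nhds p)"
      unfolding h_def by (intro tendsto_matrix_mult tendsto_column_frame a b u tendsto_const)
    then have "(h \<longlongrightarrow> g) (nhds p)"
      by (simp add: column_frame_inverse_right[OF u])
    then have "((\<lambda>q. (h q, v)) \<longlongrightarrow> (g, v)) (nhds p)"
      by (intro tendsto_intros)
    moreover have "eventually (\<lambda>q. (h q, v) \<in> homogeneous_Levi q) (nhds p)"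
      using tendsto_imp_eventually_ne[OF a u] tendsto_imp_eventually_ne[OF b u]
    proof eventually_elim
      case (elim q)
      have "h q *v snd q = column_frame (b q) *v (column_frame_inverse (a q) *v a q)"
        by (simp add: h_def a_def matrix_vector_mul_assoc matrix_mul_assoc)
      also have "\<dots> = b q"
        using elim by (simp add: column_frame_inverse_self column_frame_axis)
      finally show ?case
        using elim g by (auto simp: homogeneous_Levi_def h_def b_def intro!: SL2_mult column_frame_SL2)
    qed
    ultimately show ?thesis
      using that by blast
  qed
qed

section \<open>Cluster points and Chabauty limits\<close>

text \<open>Allows closedness and compactness relative to the group to be checked in the ambient
  vector space.\<close>

lemma closed_SL2_R2: "closed (carrier SL2_R2)"
proof -
  have "SL2 = {g :: real^2^2. g $ 1 $ 1 * g $ 2 $ 2 - g $ 1 $ 2 * g $ 2 $ 1 = 1}"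
    by (simp add: SL2_def det_2)
  moreover have "closed \<dots>"
    by (intro closed_Collect_eq continuous_intros)
  ultimately show ?thesis
    by (simp add: SL2_R2_def closed_Times)
qed

lemma homogeneous_Levi_subset: "homogeneous_Levi p \<subseteq> carrier SL2_R2"
  by (auto simp: homogeneous_Levi_def SL2_R2_def)

text \<open>The witness is a cluster point on the unit sphere of the parameters of those Levi subgroups
  that lie close to \<open>H\<close>.\<close>

lemma closure_of_Levi_cluster_point:
  assumes H: "H \<in> T closure_of Levi_subgroups"
  obtains p where "p \<noteq> 0"
    "\<And>W U. open W \<Longrightarrow> p \<in> W \<Longrightarrow> openin T U \<Longrightarrow> H \<in> U \<Longrightarrow>
      \<exists>q\<in>W. homogeneous_Levi q \<in> U"
proof -
  \<comment> \<open>\<open>sgn\<close> divides a nonzero vector by its norm, so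
    \<open>\<sigma>\<close> projects the affine chart radially to the sphere.\<close>
  define \<sigma> where "\<sigma> w = sgn (1 :: real, w)" for w :: "real^2"
  have nz: "(1 :: real, w) \<noteq> 0" for w :: "real^2"
    by (simp add: prod_eq_iff)
  have \<sigma>_sphere: "\<sigma> w \<in> sphere 0 1" for w
    using nz[of w] by (simp add: \<sigma>_def norm_sgn)
  have \<sigma>_Levi: "homogeneous_Levi (\<sigma> w) = homogeneous_Levi (1, w)" for w
    using nz[of w] unfolding \<sigma>_def sgn_div_norm by (intro homogeneous_Levi_scale) simp
  define S where "S U = closure (\<sigma> ` {w. homogeneous_Levi (1, w) \<in> U})" for U
  define \<U> where "\<U> = {U. openin T U \<and> H \<in> U}"
  have HT: "H \<in> topspace T"
    using H by (simp add: in_closure_of)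
  have "sphere 0 1 \<inter> \<Inter> (S ` \<U>) \<noteq> {}"
  proof (rule compact_imp_fip)
    fix F' assume F': "finite F'" "F' \<subseteq> S ` \<U>"
    then obtain F where F: "finite F" "F \<subseteq> \<U>" "F' = S ` F"
      by (meson finite_subset_image)
    \<comment> \<open>Finitely many neighbourhoods of \<open>H\<close> intersect in a neighbourhood,
      which contains a Levi subgroup because \<open>H\<close> lies in the closure. The factor
      \<open>topspace T\<close> keeps \<open>V\<close> open when \<open>F\<close> is empty.\<close>
    define V where "V = topspace T \<inter> \<Inter> F"
    have "openin T V"
      unfolding V_def using F by (intro openin_Int_Inter) (auto simp: \<U>_def)
    moreover have "H \<in> V"
      using F HT by (auto simp: V_def \<U>_def)
    ultimately obtain w where w: "homogeneous_Levi (1, w) \<in> V"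
      using H by (auto simp: in_closure_of Levi_subgroups_eq)
    then have "\<sigma> w \<in> S U" if "U \<in> F" for U
      using that unfolding S_def V_def by (intro subsetD[OF closure_subset]) auto
    then show "sphere 0 1 \<inter> \<Inter> F' \<noteq> {}"
      using \<sigma>_sphere F(3) by blast
  qed (auto simp: S_def)
  then obtain p where "p \<in> sphere 0 1 \<inter> \<Inter> (S ` \<U>)"
    by blast
  then have p: "norm p = 1" "\<And>U. openin T U \<Longrightarrow> H \<in> U \<Longrightarrow> p \<in> S U"
    by (simp_all add: \<U>_def)
  show ?thesis
  proof
    show "p \<noteq> 0"
      using p(1) by auto
    fix W U assume "open W" "p \<in> W" "openin T U" "H \<in> U"
    then obtain w where "homogeneous_Levi (1, w) \<in> U" "\<sigma> w \<in> W"
      using p(2)[of U] open_Int_closure_eq_empty[of W] unfolding S_def by blast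
    then show "\<exists>q\<in>W. homogeneous_Levi q \<in> U"
      using \<sigma>_Levi by metis
  qed
qed

text \<open>A point violating either inclusion yields a subbasic Chabauty neighbourhood of
  \<open>H\<close> that contains no \<open>homogeneous_Levi q\<close> with \<open>q\<close> near
  \<open>p\<close>, against the choice of \<open>p\<close>. Sets meeting an open set give one
  inclusion, sets avoiding a compact set the other.\<close>

lemma Chabauty_limit_is_homogeneous_Levi:
  assumes "H \<in> chabauty_topology SL2_R2 SL2_R2_topology closure_of Levi_subgroups"
  obtains p where "p \<noteq> 0" "H = homogeneous_Levi p"
proof -
  let ?T = "chabauty_topology SL2_R2 SL2_R2_topology"
  let ?G = "carrier SL2_R2"
  obtain p where p0: "p \<noteq> 0" and
    p: "\<And>W U. open W \<Longrightarrow> p \<in> W \<Longrightarrow> openin ?T U \<Longrightarrow> H \<in> U \<Longrightarrow> \<exists>q\<in>W. homogeneous_Levi q \<in> U"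
    using closure_of_Levi_cluster_point[OF assms] by metis
  have "H \<in> topspace ?T"
    using assms by (simp add: in_closure_of)
  then have H: "H \<in> closed_subgroups SL2_R2 SL2_R2_topology"
    by simp
  then have "closedin (top_of_set ?G) H"
    by (simp add: closed_subgroups_def SL2_R2_topology_def)
  then have clH: "closed H" and HG: "H \<subseteq> ?G"
    using closed_SL2_R2 closedin_closed_trans closedin_subset by fastforce+
  have "H \<subseteq> homogeneous_Levi p"
  proof
    fix x assume x: "x \<in> H"
    \<comment> \<open>\<open>Z\<close> is the incidence relation between parameters and points. Its
      closedness is upper semicontinuity: a box around \<open>(p, x)\<close> avoiding
      \<open>Z\<close> keeps all subgroups with parameter in \<open>W\<close> away from
      \<open>V\<close>.\<close>
    define Z :: "((real \<times> (real^2)) \<times> ((real^2^2) \<times> (real^2))) set" where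
      "Z = {z. snd (fst z) - fst (snd z) *v snd (fst z) = fst (fst z) *\<^sub>R snd (snd z)}"
    have "closed Z"
      unfolding Z_def matrix_vector_mult_def
      by (intro closed_Collect_eq continuous_intros continuous_on_vec_lambda)
    then have Z: "open (- Z)" by (simp add: open_Compl)
    show "x \<in> homogeneous_Levi p"
    proof (rule ccontr)
      assume "x \<notin> homogeneous_Levi p"
      then have "(p, x) \<in> - Z"
        using x HG by (auto simp: Z_def homogeneous_Levi_def SL2_R2_def)
      then obtain W V where WV: "open W" "open V" "p \<in> W" "x \<in> V" "W \<times> V \<subseteq> - Z"
        using open_prod_elim[OF Z] by (metis mem_Sigma_iff)
      have "openin ?T {K \<in> closed_subgroups SL2_R2 SL2_R2_topology. K \<inter> (?G \<inter> V) \<noteq> {}}"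
        unfolding chabauty_topology_def using WV(2)
        by (intro topology_generated_by_Basis UnI2)
          (auto simp: SL2_R2_topology_def intro: openin_open_Int)
      moreover have "H \<in> {K \<in> closed_subgroups SL2_R2 SL2_R2_topology. K \<inter> (?G \<inter> V) \<noteq> {}}"
        using H x HG WV(4) by auto
      ultimately obtain q where "q \<in> W" "homogeneous_Levi q \<inter> (?G \<inter> V) \<noteq> {}"
        using p[OF WV(1,3)] by blast
      then show False
        using WV(5) by (fastforce simp: Z_def homogeneous_Levi_def)
    qed
  qed
  moreover have "homogeneous_Levi p \<subseteq> H"
  proof
    fix x assume x: "x \<in> homogeneous_Levi p"
    show "x \<in> H"
    proof (rule ccontr)
      assume "x \<notin> H"
      \<comment> \<open>The closed ball supplies the compact set that \<open>H\<close> avoids; its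
        open interior eventually contains the local section, so nearby subgroups meet that compact
        set.\<close>
      then obtain e where e: "e > 0" "cball x e \<subseteq> - H"
        using clH open_contains_cball[of "- H"] by (auto simp: open_Compl)
      obtain \<Phi> where \<Phi>: "(\<Phi> \<longlongrightarrow> x) (nhds p)"
        "eventually (\<lambda>q. \<Phi> q \<in> homogeneous_Levi q) (nhds p)"
        using homogeneous_Levi_local_section[OF _ p0, of "fst x" "snd x"] x by auto
      have "eventually (\<lambda>q. \<Phi> q \<in> ball x e) (nhds p)"
        using \<Phi>(1) e(1) by (intro topological_tendstoD) auto
      with \<Phi>(2) have "eventually (\<lambda>q. \<Phi> q \<in> homogeneous_Levi q \<inter> ball x e) (nhds p)"
        by eventually_elim auto
      then obtain W where W: "open W" "p \<in> W" "\<And>q. q \<in> W \<Longrightarrow> \<Phi> q \<in> homogeneous_Levi q \<inter> ball x e"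
        unfolding eventually_nhds by blast
      have "compactin SL2_R2_topology (?G \<inter> cball x e)"
        using closed_SL2_R2
        by (auto simp: SL2_R2_topology_def compactin_subtopology closed_Int_compact)
      then have "openin ?T {K \<in> closed_subgroups SL2_R2 SL2_R2_topology. K \<inter> (?G \<inter> cball x e) = {}}"
        unfolding chabauty_topology_def by (intro topology_generated_by_Basis UnI1) auto
      moreover have "H \<in> {K \<in> closed_subgroups SL2_R2 SL2_R2_topology. K \<inter> (?G \<inter> cball x e) = {}}"
        using H e(2) by auto
      ultimately obtain q where q: "q \<in> W" "homogeneous_Levi q \<inter> (?G \<inter> cball x e) = {}"
        using p[OF W(1,2)] by blast
      then show False
        using W(3)[of q] homogeneous_Levi_subset[of q] ball_subset_cball[of x e] by blast
    qed
  qed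
  ultimately show ?thesis
    using that p0 by blast
qed

theorem theorem1:
  fixes H :: "((real^2^2) \<times> (real^2)) set"
  assumes "H \<in> (chabauty_topology SL2_R2 SL2_R2_topology) closure_of Levi_subgroups"
  shows "H \<in> Levi_subgroups \<or>
         (\<exists>x \<in> carrier SL2_R2. H = conjugate_subgroup SL2_R2 x N_plus_R2)"
proof -
  obtain s u where su: "(s, u) \<noteq> 0" "H = homogeneous_Levi (s, u)"
    using Chabauty_limit_is_homogeneous_Levi[OF assms] by (metis surj_pair)
  show ?thesis
  proof (cases "s = 0")
    case True
    then have "u \<noteq> 0"
      using su(1) by (simp add: prod_eq_iff)
    then have "(column_frame u, 0) \<in> carrier SL2_R2"
      by (simp add: SL2_R2_def column_frame_SL2)
    then show ?thesis
      using homogeneous_Levi_at_infinity[OF \<open>u \<noteq> 0\<close>] su(2) True by blast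
  next
    case False
    then show ?thesis
      using homogeneous_Levi_in_Levi_subgroups su(2) by blast
  qed
qed

end
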